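(* Let $S_1$ and $S_2$ be numerical semigroups minimally generated by $n_1<\cdots<n_r$ and $n_{r+1}<\cdots<n_e$ respectively, and suppose that $k[[S_1]]$ and $k[[S_2]]$ have maximal reduced type. Let $S = S_1+_{\lambda\mu}S_2$ be a gluing of $S_1$ and $S_2$. If $\lambda+\mu > \max\{\lambda n_1, \mu n_{r+1}\}$, then $k[[S]]$ has maximal reduced type.
   Context: $\mathbb{N}$ denotes the non-negative integers. A numerical semigroup is a submonoid $S$ of $(\mathbb{N},+)$ with $\mathbb{N}\setminus S$ finite; it has a unique minimal generating set, and $\langle a_1,\ldots,a_q\rangle$ denotes the submonoid generated by $a_1,\ldots,a_q$. The case $S=\mathbb{N}$ is allowed. The multiplicity $m(S)$ is the smallest nonzero element of $S$, and the Frobenius number $\mathrm{F}(S)$ is the largest integer not in $S$ (so $\mathrm{F}(\mathbb{N})=-1$). A pseudo-Frobenius number of $S$ is an integer $f\notin S$ with $f+s\in S$ for all $s\in S\setminus\{0\}$; $\mathrm{PF}(S)$ is the set of these. Gluing: let $S_1$, $S_2$ be minimally generated by $n_1,\ldots,n_r$ and $n_{r+1},\ldots,n_e$. Let $\mu\in S_1\setminus\{n_1,\ldots,n_r\}$ and $\lambda\in S_2\setminus\{n_{r+1},\ldots,n_e\}$ with $\gcd(\lambda,\mu)=1$. Then $S_1+_{\lambda\mu}S_2 := \langle \lambda n_1,\ldots,\lambda n_r,\mu n_{r+1},\ldots,\mu n_e\rangle$ is called a gluing of $S_1$ and $S_2$. Let $k$ be an algebraically closed field of characteristic zero. For $S$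 with minimal generators $a_1,\ldots,a_q$, $R=k[[S]] := k[[t^{a_1},\ldots,t^{a_q}]]\subseteq k[[t]]$. The type, $\mathrm{type}(k[[S]])$, is the Cohen-Macaulay type of $k[[S]]$, which equals $|\mathrm{PF}(S)|$. With $K$ the quotient field of $R$, $\bar R$ its integral closure in $K$ and $\mathfrak{C}=(R:_K\bar R)$ the conductor ideal, the reduced type is $s(R)=\dim_k \frac{\mathfrak{C}+xR}{xR}$ with $x=t^{m(S)}$; it satisfies $1\le s(R)\le \mathrm{type}(R)$, and it is known to equal the number of integers in $[\mathrm{F}(S)-m(S)+1,\mathrm{F}(S)]\setminus S$. $R$ has maximal reduced type if $s(R)=\mathrm{type}(R)$. *)

theory Defs
  imports "HOL-Computational_Algebra.Computational_Algebra"
begin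

section \<open>Numerical semigroups\<close>

definition submonoid :: "nat set \<Rightarrow> bool" where
  "submonoid S \<longleftrightarrow> 0 \<in> S \<and> (\<forall>a\<in>S. \<forall>b\<in>S. a + b \<in> S)"

definition numerical_semigroup :: "nat set \<Rightarrow> bool" where
  "numerical_semigroup S \<longleftrightarrow> submonoid S \<and> finite (UNIV - S)"

definition minimally_generates :: "nat set \<Rightarrow> nat set \<Rightarrow> bool" where
  "minimally_generates A S \<longleftrightarrow>
     submonoid hull A = S \<and> (\<forall>B. B \<subset> A \<longrightarrow> submonoid hull B \<noteq> S)"

definition minimal_generators :: "nat set \<Rightarrow> nat set" where
  "minimal_generators S = (THE A. minimally_generates A S)"

definition semigroup_multiplicity :: "nat set \<Rightarrow> nat" where
  "semigroup_multiplicity S = (LEAST s. s \<in> S \<and> s \<noteq> 0)"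

text \<open>The semigroup \<open>S\<^sub>1 +\<^bsub>lm\<^esub> S\<^sub>2\<close>, where \<open>A\<close> and \<open>B\<close> are the minimal generating sets of
  \<open>S\<^sub>1\<close> and \<open>S\<^sub>2\<close>.\<close>

definition glue :: "nat \<Rightarrow> nat \<Rightarrow> nat set \<Rightarrow> nat set \<Rightarrow> nat set" where
  "glue l m A B = submonoid hull ((\<lambda>a. l * a) ` A \<union> (\<lambda>b. m * b) ` B)"

definition is_gluing ::
  "nat set \<Rightarrow> nat \<Rightarrow> nat \<Rightarrow> nat set \<Rightarrow> nat set \<Rightarrow> nat set \<Rightarrow> nat set \<Rightarrow> bool" where
  "is_gluing S l m S\<^sub>1 A S\<^sub>2 B \<longleftrightarrow>
     minimally_generates A S\<^sub>1 \<and> minimally_generates B S\<^sub>2 \<and>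
     m \<in> S\<^sub>1 - A \<and> l \<in> S\<^sub>2 - B \<and> gcd l m = 1 \<and> S = glue l m A B"

lemma submonoid_hull [simp]: "submonoid (submonoid hull A)"
  by (rule hull_in) (auto simp: submonoid_def)

lemma minimally_generates_iff:
  assumes "submonoid S"
  shows "minimally_generates A S \<longleftrightarrow>
    A = {s \<in> S - {0}. \<forall>a\<in>S - {0}. \<forall>b\<in>S - {0}. s \<noteq> a + b}" (is "_ \<longleftrightarrow> A = ?M")
proof -
  have sub: "s \<in> submonoid hull ?M" if "s \<in> S" for s
    using that
  proof (induction s rule: less_induct)
    case (less s)
    consider "s = 0" | "s \<in> ?M" | a b where "a \<in> S - {0}" "b \<in> S - {0}" "s = a + b"
      using less.prems by blast
    then show ?case
    proof cases
      case 1
      then show ?thesis using submonoid_hull[of ?M] unfolding submonoid_def by simp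
    next
      case 2
      then show ?thesis by (rule hull_inc)
    next
      case 3
      then have "a \<in> submonoid hull ?M" "b \<in> submonoid hull ?M"
        using less.IH[of a] less.IH[of b] by auto
      then show ?thesis using submonoid_hull[of ?M] 3 unfolding submonoid_def by simp
    qed
  qed
  have gen: "submonoid hull ?M = S"
    using sub hull_minimal[of ?M S submonoid] assms by blast
  have incl: "?M \<subseteq> B" if "submonoid hull B = S" for B
  proof
    fix s assume s: "s \<in> ?M"
    show "s \<in> B"
    proof (rule ccontr)
      assume "s \<notin> B"
      then have B: "B \<subseteq> S - {s}" using hull_subset[of B submonoid] that by auto
      have "a + b \<in> S - {s}" if "a \<in> S - {s}" "b \<in> S - {s}" for a b
        using that s assms unfolding submonoid_def by (cases "a = 0"; cases "b = 0") auto
      then have "submonoid (S - {s})" using s assms unfolding submonoid_def by auto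
      from hull_minimal[of _ _ submonoid, OF B this] show False using that s by auto
    qed
  qed
  show ?thesis
  proof
    assume A: "minimally_generates A S"
    then have "?M \<subseteq> A" using incl unfolding minimally_generates_def by simp
    moreover have "?M \<subset> A \<Longrightarrow> submonoid hull ?M \<noteq> S"
      using A unfolding minimally_generates_def by (elim conjE allE impE)
    ultimately show "A = ?M" using gen by (metis (lifting) psubsetI)
  next
    assume "A = ?M"
    moreover have "submonoid hull B \<noteq> S" if "B \<subset> ?M" for B
      using incl[of B] that by (meson leD)
    ultimately show "minimally_generates A S" unfolding minimally_generates_def using gen by simp
  qed
qed

lemma minimal_generators_eq:
  assumes "submonoid S"
  shows "minimally_generates A S \<longleftrightarrow> A = minimal_generators S"
  unfolding minimal_generators_def minimally_generates_iff[OF assms] by simp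

lemma finite_minimal_generators:
  assumes "numerical_semigroup S"
  shows "finite (minimal_generators S)" "0 \<notin> minimal_generators S"
proof -
  let ?M = "{s \<in> S - {0}. \<forall>a\<in>S - {0}. \<forall>b\<in>S - {0}. s \<noteq> a + b}"
  have S: "submonoid S" "finite (UNIV - S)"
    using assms unfolding numerical_semigroup_def by auto
  have M: "minimal_generators S = ?M"
    using minimally_generates_iff[OF S(1), of ?M] minimal_generators_eq[OF S(1), of ?M] by simp
  show "0 \<notin> minimal_generators S" unfolding M by simp
  have "infinite (S - {0})"
  proof
    assume "finite (S - {0})"
    then have "finite ((UNIV - S) \<union> (S - {0}) \<union> {0})" using S(2) by blast
    moreover have "(UNIV - S) \<union> (S - {0}) \<union> {0} = UNIV" by auto
    ultimately show False by (metis infinite_UNIV_nat)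
  qed
  then obtain m where m: "m \<in> S - {0}" by (metis finite.emptyI ex_in_conv)
  have "?M \<subseteq> {..m} \<union> (\<lambda>b. m + b) ` (UNIV - S)"
  proof
    fix s assume s: "s \<in> ?M"
    show "s \<in> {..m} \<union> (\<lambda>b. m + b) ` (UNIV - S)"
    proof (cases "s \<le> m")
      case False
      then have *: "s = m + (s - m)" "s - m \<in> UNIV - {0}" by auto
      have "s - m \<notin> S"
      proof
        assume "s - m \<in> S"
        then have "s - m \<in> S - {0}" using * by simp
        moreover have "\<forall>b\<in>S - {0}. s \<noteq> m + b" using s m by simp
        ultimately show False using *(1) by metis
      qed
      then show ?thesis using *(1) by blast
    qed simp
  qed
  then show "finite (minimal_generators S)"
    unfolding M using S(2) by (meson finite_UnI finite_atMost finite_imageI finite_subset)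
qed


section \<open>The ring \<open>k[[S]]\<close>\<close>

text \<open>The ring \<open>k[[t\<^sup>a | a \<in> A]]\<close> is the image of the substitution \<open>y\<^sub>a \<mapsto> t\<^sup>a\<close> on the power series
  \<open>\<Sum>\<^sub>\<alpha> c\<^sub>\<alpha> y\<^sup>\<alpha>\<close> in variables \<open>y\<^sub>a\<close>, \<open>a \<in> A\<close>. Here \<open>A\<close> is finite and \<open>0 \<notin> A\<close>, so only finitely many
  multi-indices contribute to each coefficient. The ring is placed inside the field
  \<open>k((t))\<close>, where its quotient field can be formed.\<close>

definition multi_indices :: "nat set \<Rightarrow> nat \<Rightarrow> (nat \<Rightarrow> nat) set" where
  "multi_indices A n = {\<alpha>. (\<forall>a. a \<notin> A \<longrightarrow> \<alpha> a = 0) \<and> (\<Sum>a\<in>A. \<alpha> a * a) = n}"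

definition monomial_power_series :: "nat set \<Rightarrow> 'k::field fls set" where
  "monomial_power_series A =
     range (\<lambda>c :: (nat \<Rightarrow> nat) \<Rightarrow> 'k. fps_to_fls (Abs_fps (\<lambda>n. \<Sum>\<alpha>\<in>multi_indices A n. c \<alpha>)))"

definition semigroup_ring :: "nat set \<Rightarrow> 'k::field fls set" where
  "semigroup_ring S = monomial_power_series (minimal_generators S)"

lemma finite_multi_indices:
  assumes "finite A" "0 \<notin> A"
  shows "finite (multi_indices A n)"
proof -
  have "\<alpha> a \<le> n" if "\<alpha> \<in> multi_indices A n" for \<alpha> a
  proof (cases "a \<in> A")
    case True
    then have "\<alpha> a * a \<le> n"
      using that assms(1) member_le_sum[of a A "\<lambda>a. \<alpha> a * a"] unfolding multi_indices_def by auto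
    moreover have "a > 0" using True assms(2) by (metis gr0I)
    ultimately show ?thesis
      by (metis le_trans mult.commute One_nat_def Suc_leI mult_le_mono1 nat_mult_1)
  qed (use that in \<open>auto simp: multi_indices_def\<close>)
  then have "multi_indices A n \<subseteq>
      {\<alpha>. \<forall>a. (a \<in> A \<longrightarrow> \<alpha> a \<in> {..n}) \<and> (a \<notin> A \<longrightarrow> \<alpha> a = 0)}"
    unfolding multi_indices_def by auto
  then show ?thesis
    by (rule finite_subset) (rule finite_set_of_finite_funs[OF assms(1) finite_atMost])
qed

lemma multi_indices_nonempty_iff:
  assumes "finite A"
  shows "multi_indices A n \<noteq> {} \<longleftrightarrow> n \<in> submonoid hull A"
proof
  assume "multi_indices A n \<noteq> {}"
  then obtain \<alpha> where n: "n = (\<Sum>a\<in>A. \<alpha> a * a)" unfolding multi_indices_def by auto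
  have *: "0 \<in> submonoid hull A"
    "\<And>a b. a \<in> submonoid hull A \<Longrightarrow> b \<in> submonoid hull A \<Longrightarrow> a + b \<in> submonoid hull A"
    using submonoid_hull[of A] unfolding submonoid_def by auto
  have **: "k * a \<in> submonoid hull A" if "a \<in> A" for k a
    by (induction k) (use that * in \<open>auto intro: hull_inc\<close>)
  have "(\<Sum>a\<in>B. \<alpha> a * a) \<in> submonoid hull A" if "finite B" "B \<subseteq> A" for B
    using that by (induction B rule: finite_induct) (use * ** in auto)
  then show "n \<in> submonoid hull A" using n assms by blast
next
  assume "n \<in> submonoid hull A"
  then show "multi_indices A n \<noteq> {}"
  proof (rule hull_induct)
    fix a assume "a \<in> A"
    then have "(\<lambda>b. if b = a then 1 else 0) \<in> multi_indices A a"
      unfolding multi_indices_def using assms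
      by (auto simp: if_distrib[of "\<lambda>x. x * _"] cong: if_cong)
    then show "multi_indices A a \<noteq> {}" by blast
  next
    have "(\<lambda>_. 0) \<in> multi_indices A 0" unfolding multi_indices_def by simp
    moreover have "(\<lambda>c. \<alpha> c + \<beta> c) \<in> multi_indices A (a + b)"
      if "\<alpha> \<in> multi_indices A a" "\<beta> \<in> multi_indices A b" for \<alpha> \<beta> a b
      using that unfolding multi_indices_def by (auto simp: sum.distrib add_mult_distrib)
    ultimately show "submonoid {n. multi_indices A n \<noteq> {}}"
      unfolding submonoid_def by blast
  qed
qed

lemma monomial_power_series_eq:
  assumes "finite A" "0 \<notin> A"
  shows "monomial_power_series A =
    fps_to_fls ` {f :: 'k::field fps. \<forall>n. n \<notin> submonoid hull A \<longrightarrow> fps_nth f n = 0}"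
proof (intro equalityI subsetI)
  fix g :: "'k fls" assume "g \<in> monomial_power_series A"
  then show "g \<in> fps_to_fls ` {f. \<forall>n. n \<notin> submonoid hull A \<longrightarrow> fps_nth f n = 0}"
    unfolding monomial_power_series_def using multi_indices_nonempty_iff[OF assms(1)] by fastforce
next
  fix g :: "'k fls"
  assume "g \<in> fps_to_fls ` {f. \<forall>n. n \<notin> submonoid hull A \<longrightarrow> fps_nth f n = 0}"
  then obtain f where f: "g = fps_to_fls f" "\<And>n. n \<notin> submonoid hull A \<Longrightarrow> fps_nth f n = 0"
    by auto
  define sel where "sel n = (SOME \<alpha>. \<alpha> \<in> multi_indices A n)" for n
  define c where "c \<alpha> = (let n = (\<Sum>a\<in>A. \<alpha> a * a) in if \<alpha> = sel n then fps_nth f n else 0)" for \<alpha>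
  have "(\<Sum>\<alpha>\<in>multi_indices A n. c \<alpha>) = fps_nth f n" for n
  proof (cases "multi_indices A n = {}")
    case True
    then show ?thesis using f(2) multi_indices_nonempty_iff[OF assms(1)] by force
  next
    case False
    then have "sel n \<in> multi_indices A n" unfolding sel_def by (simp add: some_in_eq)
    moreover have "(\<Sum>\<alpha>\<in>multi_indices A n. c \<alpha>) =
        (\<Sum>\<alpha>\<in>multi_indices A n. if \<alpha> = sel n then fps_nth f n else 0)"
      by (rule sum.cong) (auto simp: c_def multi_indices_def)
    ultimately show ?thesis using finite_multi_indices[OF assms] by simp
  qed
  then have "Abs_fps (\<lambda>n. \<Sum>\<alpha>\<in>multi_indices A n. c \<alpha>) = f" by (simp add: fps_eq_iff)
  then show "g \<in> monomial_power_series A" unfolding monomial_power_series_def f(1) by auto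
qed

lemma semigroup_ring_eq:
  assumes "numerical_semigroup S"
  shows "semigroup_ring S = fps_to_fls ` {f :: 'k::field fps. \<forall>n. n \<notin> S \<longrightarrow> fps_nth f n = 0}"
proof -
  have S: "submonoid S" using assms unfolding numerical_semigroup_def by auto
  have "submonoid hull (minimal_generators S) = S"
    using minimal_generators_eq[OF S] unfolding minimally_generates_def by blast
  then show ?thesis
    unfolding semigroup_ring_def
    using monomial_power_series_eq[OF finite_minimal_generators[OF assms]] by simp
qed


section \<open>Dimension of a quotient space\<close>

locale vector_space_quotient = vector_space scale
  for scale :: "'a::field \<Rightarrow> 'b::ab_group_add \<Rightarrow> 'b" (infixr \<open>*s\<close> 75)
begin

text \<open>The residue classes of the elements of \<open>B\<close> form a basis of \<open>V / W\<close> (and are distinct).\<close>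

definition quotient_basis :: "'b set \<Rightarrow> 'b set \<Rightarrow> 'b set \<Rightarrow> bool" where
  "quotient_basis V W B \<longleftrightarrow>
     B \<subseteq> V \<and>
     (\<forall>T c. finite T \<longrightarrow> T \<subseteq> B \<longrightarrow> (\<Sum>v\<in>T. c v *s v) \<in> W \<longrightarrow> (\<forall>v\<in>T. c v = 0)) \<and>
     V = {b + w | b w. b \<in> span B \<and> w \<in> W}"

text \<open>As with \<^term>\<open>dim\<close>, the value is \<open>0\<close> if \<open>V / W\<close> has infinite dimension.\<close>

definition quotient_dim :: "'b set \<Rightarrow> 'b set \<Rightarrow> nat" where
  "quotient_dim V W = card (SOME B. quotient_basis V W B)"

lemma quotient_basis_card_le:
  assumes W: "subspace W" and B: "quotient_basis V W B" and C: "quotient_basis V W C"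
    and fin: "finite C"
  shows "finite B \<and> card B \<le> card C"
proof -
  have "\<forall>b\<in>B. \<exists>u. u \<in> span C \<and> b - u \<in> W"
  proof
    fix b assume "b \<in> B"
    then have "b \<in> V" using B unfolding quotient_basis_def by auto
    then obtain u w where "b = u + w" "u \<in> span C" "w \<in> W"
      using C unfolding quotient_basis_def by blast
    then show "\<exists>u. u \<in> span C \<and> b - u \<in> W" by (intro exI[of _ u]) auto
  qed
  then obtain u where u: "\<And>b. b \<in> B \<Longrightarrow> u b \<in> span C" "\<And>b. b \<in> B \<Longrightarrow> b - u b \<in> W"
    by metis
  have indep: "\<forall>v\<in>T. c v = 0"
    if T: "finite T" "T \<subseteq> B" and 0: "(\<Sum>v\<in>T. c v *s u v) = 0" for T c
  proof -
    have "(\<Sum>v\<in>T. c v *s (v - u v)) \<in> W"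
      using T u(2) by (intro subspace_sum[OF W] subspace_scale[OF W]) auto
    then have "(\<Sum>v\<in>T. c v *s v) \<in> W"
      using 0 by (simp add: scale_right_diff_distrib sum_subtractf)
    then show ?thesis using B T unfolding quotient_basis_def by blast
  qed
  have inj: "inj_on u B"
  proof (rule inj_onI, rule ccontr)
    fix x y assume xy: "x \<in> B" "y \<in> B" "u x = u y" "x \<noteq> y"
    have "(\<Sum>v\<in>{x, y}. (if v = x then 1 else - 1) *s u v) = 0"
      using xy by simp
    from indep[OF _ _ this] xy show False by auto
  qed
  have "independent (u ` B)"
    unfolding independent_explicit_finite_subsets
  proof (intro allI impI)
    fix T c assume T: "T \<subseteq> u ` B" "finite T" and 0: "(\<Sum>v\<in>T. c v *s v) = 0"
    obtain T' where T': "T' \<subseteq> B" "T = u ` T'" using T(1) by (metis subset_imageE)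
    have "inj_on u T'" using inj T'(1) inj_on_subset by blast
    then have "finite T'" "(\<Sum>v\<in>T'. c (u v) *s u v) = 0"
      using T(2) 0 T'(2) by (auto simp: finite_image_iff sum.reindex)
    from indep[OF this(1) T'(1) this(2)] show "\<forall>v\<in>T. c v = 0" using T'(2) by blast
  qed
  from independent_span_bound[OF fin this] u(1) show ?thesis
    using inj by (auto simp: finite_image_iff card_image)
qed

lemma quotient_dim_eq:
  assumes "subspace W" "quotient_basis V W B" "finite B"
  shows "quotient_dim V W = card B"
proof -
  have C: "quotient_basis V W (SOME B. quotient_basis V W B)"
    using assms(2) by (rule someI)
  from quotient_basis_card_le[OF assms(1) C assms(2,3)]
    quotient_basis_card_le[OF assms(1) assms(2) C]
  show ?thesis unfolding quotient_dim_def by linarith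
qed

end

global_interpretation fls: vector_space_quotient "\<lambda>(c :: 'k::field) f. fls_const c * f"
  defines fls_quotient_dim = fls.quotient_dim
  by unfold_locales
    (simp_all only: distrib_left distrib_right mult.assoc mult_1_left fls_const_1
      fls_plus_const[symmetric] fls_const_mult_const[symmetric])


section \<open>Type and reduced type\<close>

text \<open>In the rest of the theory a ring is a subring \<open>R\<close> of \<open>k((t))\<close>.\<close>

definition quotient_field :: "'k::field fls set \<Rightarrow> 'k fls set" where
  "quotient_field R = {a / b | a b. a \<in> R \<and> b \<in> R \<and> b \<noteq> 0}"

definition integral_closure :: "'k::field fls set \<Rightarrow> 'k fls set" where
  "integral_closure R =
     {z \<in> quotient_field R.
       \<exists>p. lead_coeff p = 1 \<and> (\<forall>i. poly.coeff p i \<in> R) \<and> poly p z = 0}"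

definition conductor :: "'k::field fls set \<Rightarrow> 'k fls set" where
  "conductor R = {z \<in> quotient_field R. \<forall>y\<in>integral_closure R. z * y \<in> R}"

definition principal_ideal :: "'k::field fls \<Rightarrow> 'k fls set \<Rightarrow> 'k fls set" where
  "principal_ideal x R = {x * a | a. a \<in> R}"

definition nonunits :: "'k::field fls set \<Rightarrow> 'k fls set" where
  "nonunits R = {a \<in> R. \<not> (\<exists>b\<in>R. a * b = 1)}"

text \<open>For a one-dimensional Cohen-Macaulay local ring \<open>R\<close> with maximal ideal \<open>\<mm>\<close>, residue field \<open>k\<close>
  and parameter \<open>x\<close>, the type is \<open>dim\<^sub>k Soc (R / xR)\<close>, where \<open>Soc (R / xR) = (xR :\<^sub>R \<mm>) / xR\<close>. It does
  not depend on \<open>x\<close>.\<close>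

definition cm_type :: "'k::field fls set \<Rightarrow> 'k fls \<Rightarrow> nat" where
  "cm_type R x =
     fls_quotient_dim {a \<in> R. \<forall>b\<in>nonunits R. a * b \<in> principal_ideal x R} (principal_ideal x R)"

definition reduced_type :: "'k::field fls set \<Rightarrow> 'k fls \<Rightarrow> nat" where
  "reduced_type R x =
     fls_quotient_dim {c + y | c y. c \<in> conductor R \<and> y \<in> principal_ideal x R} (principal_ideal x R)"

definition maximal_reduced_type :: "'k::field itself \<Rightarrow> nat set \<Rightarrow> bool" where
  "maximal_reduced_type _ S \<longleftrightarrow>
     (let R = semigroup_ring S :: 'k fls set; x = fls_X ^ semigroup_multiplicity S
      in reduced_type R x = cm_type R x)"

end

theory Submission
  imports Defs
begin

text \<open>Write \<open>F\<close>, \<open>m\<close> and \<open>PF\<close> for the Frobenius number, the multiplicity and the set of pseudo-Frobenius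
  numbers of a numerical semigroup \<open>S\<close>, all regarded as integers.

  The ring \<open>R = k[[S]]\<close> and every ideal in the definitions of the type and the reduced type consist
  of all series with a prescribed set of exponents, so the two dimensions count exponents. The socle
  modulo \<open>t\<^sup>m\<close> has the basis \<open>t\<^bsup>f + m\<^esup>\<close>, \<open>f \<in> PF\<close>. The conductor is \<open>t\<^bsup>F + 1\<^esup> k[[t]]\<close>, so its image modulo
  \<open>t\<^sup>m\<close> has the basis \<open>t\<^bsup>f + m\<^esup>\<close> with \<open>f\<close> a gap above \<open>F - m\<close>. Such gaps are pseudo-Frobenius numbers,
  whence the reduced type is maximal if and only if every pseudo-Frobenius number exceeds \<open>F - m\<close>
  (\<open>maximal_reduced_type_iff\<close>).

  For the gluing \<open>S = \<lambda> S\<^sub>1 + \<mu> S\<^sub>2\<close> this criterion follows from three facts: every \<open>p \<in> PF(S)\<close> is of the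
  form \<open>\<lambda> f + \<mu> g + \<lambda> \<mu>\<close> with \<open>f \<in> PF(S\<^sub>1)\<close> and \<open>g \<in> PF(S\<^sub>2)\<close> (\<open>pseudo_frobenius_glued\<close>);
  \<open>F(S) \<le> \<lambda> F(S\<^sub>1) + \<mu> F(S\<^sub>2) + \<lambda> \<mu>\<close> (\<open>above_bound_in_glued\<close>); and
  \<open>m(S) \<ge> min (\<lambda> m(S\<^sub>1)) (\<mu> m(S\<^sub>2))\<close> (\<open>multiplicity_glued\<close>). If \<open>S\<^sub>1\<close> and \<open>S\<^sub>2\<close> satisfy the criterion, then
  \<open>F(S) - p \<le> \<lambda> (m(S\<^sub>1) - 1) + \<mu> (m(S\<^sub>2) - 1)\<close>. The right-hand side is
  \<open>min (\<lambda> m(S\<^sub>1)) (\<mu> m(S\<^sub>2)) + max (\<lambda> m(S\<^sub>1)) (\<mu> m(S\<^sub>2)) - (\<lambda> + \<mu>)\<close>, which is less than \<open>m(S)\<close> because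
  the maximum is less than \<open>\<lambda> + \<mu>\<close>: no generator of \<open>S\<^sub>i\<close> is smaller than \<open>m(S\<^sub>i)\<close>.\<close>

unbundle fps_syntax

section \<open>Numerical semigroups inside the integers\<close>

definition pseudo_frobenius :: "nat set \<Rightarrow> int set" where
  "pseudo_frobenius S = {f. f \<notin> int ` S \<and> (\<forall>s\<in>S - {0}. f + int s \<in> int ` S)}"

text \<open>The offset from the least \<open>c\<close> with \<open>c + \<nat> \<subseteq> S\<close> is what yields the value \<open>-1\<close> for \<open>S = \<nat>\<close>.\<close>
definition frobenius_number :: "nat set \<Rightarrow> int" where
  "frobenius_number S = int (LEAST c. {c..} \<subseteq> S) - 1"

lemma int_image_submonoid:
  assumes "submonoid S"
  shows "0 \<in> int ` S" "a \<in> int ` S \<Longrightarrow> b \<in> int ` S \<Longrightarrow> a + b \<in> int ` S"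
proof -
  show "0 \<in> int ` S" using assms unfolding submonoid_def by force
  assume "a \<in> int ` S" "b \<in> int ` S"
  then obtain a' b' where "a = int a'" "b = int b'" "a' + b' \<in> S"
    using assms unfolding submonoid_def by blast
  then show "a + b \<in> int ` S" by (metis image_eqI of_nat_add)
qed

lemma int_image_submonoid_mult:
  assumes "submonoid S" "a \<in> int ` S" "0 \<le> k"
  shows "k * a \<in> int ` S"
proof -
  have "int j * a \<in> int ` S" for j
    by (induction j) (simp_all add: int_image_submonoid[OF assms(1)] assms(2) distrib_right)
  from this[of "nat k"] show ?thesis using assms(3) by simp
qed

lemma cofinite_iff_contains_tail: "finite (UNIV - S) \<longleftrightarrow> (\<exists>c::nat. {c..} \<subseteq> S)"
proof
  assume "finite (UNIV - S)"
  then obtain c where "\<forall>x\<in>UNIV - S. x < c" using finite_nat_set_iff_bounded by blast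
  then have "{c..} \<subseteq> S" by (meson DiffI UNIV_I atLeast_iff not_le subsetI)
  then show "\<exists>c::nat. {c..} \<subseteq> S" ..
next
  assume "\<exists>c::nat. {c..} \<subseteq> S"
  then obtain c where "{c..} \<subseteq> S" ..
  then have "UNIV - S \<subseteq> UNIV - {c..}" by blast
  also have "UNIV - {c..} = {..<c}" by auto
  finally have "UNIV - S \<subseteq> {..<c}" .
  then show "finite (UNIV - S)" by (rule finite_subset) simp
qed

lemma above_frobenius_number:
  assumes "numerical_semigroup S" "frobenius_number S < z"
  shows "z \<in> int ` S"
proof -
  have "\<exists>c. {c..} \<subseteq> S"
    using assms(1) cofinite_iff_contains_tail unfolding numerical_semigroup_def by blast
  then have "{(LEAST c. {c..} \<subseteq> S)..} \<subseteq> S" by (rule LeastI_ex)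
  moreover have "z = int (nat z)" "(LEAST c. {c..} \<subseteq> S) \<le> nat z"
    using assms(2) unfolding frobenius_number_def by auto
  ultimately show ?thesis by (metis atLeast_iff image_eqI subsetD)
qed

lemma frobenius_number_le:
  assumes "\<And>z. b < z \<Longrightarrow> z \<in> int ` S"
  shows "frobenius_number S \<le> b"
proof -
  have "\<not> b < -1" using assms[of "-1"] by auto
  have "x \<in> S" if "nat (b + 1) \<le> x" for x
    using assms[of "int x"] that by (auto simp: image_iff)
  then have "(LEAST c. {c..} \<subseteq> S) \<le> nat (b + 1)" by (intro Least_le) auto
  then show ?thesis unfolding frobenius_number_def using \<open>\<not> b < -1\<close> by linarith
qed

lemma semigroup_multiplicity_in:
  assumes "numerical_semigroup S"
  shows "semigroup_multiplicity S \<in> S - {0}"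
proof -
  obtain c where "{c..} \<subseteq> S"
    using assms cofinite_iff_contains_tail unfolding numerical_semigroup_def by blast
  then have "Suc c \<in> S \<and> Suc c \<noteq> 0" by auto
  then show ?thesis unfolding semigroup_multiplicity_def
    using LeastI[of "\<lambda>s. s \<in> S \<and> s \<noteq> 0"] by blast
qed

lemma semigroup_multiplicity_le:
  assumes "s \<in> S" "s \<noteq> 0"
  shows "semigroup_multiplicity S \<le> s"
  unfolding semigroup_multiplicity_def using assms by (intro Least_le) simp

text \<open>Adding the multiplicity leads from a gap into the semigroup once the gap exceeds
  \<open>F - m\<close>; adding any other nonzero element leads even further.\<close>

lemma large_gap_pseudo_frobenius:
  assumes S: "numerical_semigroup S"
    and f: "f \<notin> int ` S" "frobenius_number S - int (semigroup_multiplicity S) < f"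
  shows "f \<in> pseudo_frobenius S"
  unfolding pseudo_frobenius_def
proof (intro CollectI conjI ballI f(1))
  fix s assume "s \<in> S - {0}"
  then have "semigroup_multiplicity S \<le> s" by (auto intro: semigroup_multiplicity_le)
  then show "f + int s \<in> int ` S" using f(2) by (intro above_frobenius_number[OF S]) linarith
qed

lemma finite_pseudo_frobenius:
  assumes S: "numerical_semigroup S"
  shows "finite (pseudo_frobenius S)"
proof (rule finite_subset)
  let ?m = "int (semigroup_multiplicity S)"
  show "pseudo_frobenius S \<subseteq> {- ?m..frobenius_number S}"
  proof
    fix f assume f: "f \<in> pseudo_frobenius S"
    then have "f + ?m \<in> int ` S"
      using semigroup_multiplicity_in[OF S] unfolding pseudo_frobenius_def by blast
    moreover have "\<not> frobenius_number S < f"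
      using f above_frobenius_number[OF S, of f] unfolding pseudo_frobenius_def by blast
    ultimately show "f \<in> {- ?m..frobenius_number S}" by auto
  qed
qed simp


section \<open>Monomial subspaces of the Laurent series\<close>

definition supported_series :: "int set \<Rightarrow> 'k::field fls set" where
  "supported_series E = {f. \<forall>n. f $$ n \<noteq> 0 \<longrightarrow> n \<in> E}"

lemma supported_seriesD: "f \<in> supported_series E \<Longrightarrow> f $$ n \<noteq> 0 \<Longrightarrow> n \<in> E"
  unfolding supported_series_def by blast

lemma supported_series_nth_eq_0: "f \<in> supported_series E \<Longrightarrow> n \<notin> E \<Longrightarrow> f $$ n = 0"
  unfolding supported_series_def by blast

lemma supported_series_mono: "E \<subseteq> E' \<Longrightarrow> supported_series E \<subseteq> supported_series E'"
  unfolding supported_series_def by blast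

lemma supported_series_subspace: "fls.subspace (supported_series E :: 'k::field fls set)"
  unfolding fls.subspace_def supported_series_def by (auto; metis add_0)

lemma fls_X_power_in_supported_series:
  "(fls_X ^ j :: 'k::field fls) \<in> supported_series E \<longleftrightarrow> int j \<in> E"
  unfolding supported_series_def by simp

lemma fls_mult_nth_nonzero:
  fixes f g :: "'k::field fls"
  assumes "(f * g) $$ n \<noteq> 0"
  obtains i where "f $$ i \<noteq> 0" "g $$ (n - i) \<noteq> 0"
proof -
  have "\<exists>i\<in>{fls_subdegree f..n - fls_subdegree g}. f $$ i * g $$ (n - i) \<noteq> 0"
    using assms unfolding fls_times_nth(2) by (metis (no_types, lifting) sum.neutral)
  then show thesis using that by auto
qed

lemma fls_X_power_times_nth:
  fixes f :: "'k::field fls"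
  shows "(fls_X ^ m * f) $$ n = f $$ (n - int m)"
  by (simp add: fls_X_power_times_conv_shift)

lemma mult_fls_X_power_supported_iff:
  fixes f :: "'k::field fls"
  shows "fls_X ^ m * f \<in> supported_series E \<longleftrightarrow> (\<forall>n. f $$ n \<noteq> 0 \<longrightarrow> n + int m \<in> E)"
  unfolding supported_series_def fls_X_power_times_nth mem_Collect_eq
  by (metis add_diff_cancel_right' diff_add_cancel)

lemma mult_supported_series:
  fixes f g :: "'k::field fls"
  assumes "f \<in> supported_series D" "g \<in> supported_series E"
    and "\<And>i j. i \<in> D \<Longrightarrow> j \<in> E \<Longrightarrow> i + j \<in> G"
  shows "f * g \<in> supported_series G"
proof -
  have "n \<in> G" if "(f * g) $$ n \<noteq> 0" for n
    using that
  proof (rule fls_mult_nth_nonzero)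
    fix i assume "f $$ i \<noteq> 0" "g $$ (n - i) \<noteq> 0"
    then have "i + (n - i) \<in> G" using assms by (intro assms(3)) (auto dest: supported_seriesD)
    then show ?thesis by simp
  qed
  then show ?thesis unfolding supported_series_def by blast
qed

text \<open>A series is split by restricting it to the exponents in \<open>D\<close>; the lower bound on \<open>D\<close> makes the
  restriction a Laurent series.\<close>

lemma supported_series_sum:
  "{f + g | f g. f \<in> supported_series D \<and> g \<in> supported_series E} =
    (supported_series (D \<union> E) :: 'k::field fls set)"
  if "D \<subseteq> {b..}" for D E b
proof (intro equalityI subsetI)
  fix h :: "'k fls"
  assume "h \<in> {f + g | f g. f \<in> supported_series D \<and> g \<in> supported_series E}"
  then obtain f g where h: "h = f + g" "f \<in> supported_series D" "g \<in> supported_series E" by blast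
  have "f \<in> supported_series (D \<union> E)" "g \<in> supported_series (D \<union> E)"
    using h supported_series_mono by blast+
  then show "h \<in> supported_series (D \<union> E)"
    unfolding h(1) by (rule fls.subspace_add[OF supported_series_subspace])
next
  fix h :: "'k fls" assume h: "h \<in> supported_series (D \<union> E)"
  define f where "f = Abs_fls (\<lambda>n. if n \<in> D then h $$ n else 0)"
  have f: "f $$ n = (if n \<in> D then h $$ n else 0)" for n
    unfolding f_def by (rule nth_Abs_fls_lower_bound[of b]) (use that in auto)
  have "f \<in> supported_series D" unfolding supported_series_def by (auto simp: f split: if_splits)
  moreover have "h - f \<in> supported_series E"
    using h unfolding supported_series_def by (auto simp: f split: if_splits)
  ultimately show "h \<in> {f + g | f g. f \<in> supported_series D \<and> g \<in> supported_series E}"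
    by (intro CollectI exI[of _ f] exI[of _ "h - f"]) simp
qed

text \<open>The monomials whose exponents lie in \<open>D\<close> but not in \<open>E\<close> represent a basis of the quotient.\<close>

lemma quotient_dim_supported_series:
  assumes E: "E \<subseteq> D" and fin: "finite (D - E)" and nonneg: "D \<subseteq> {0..}"
  shows "fls_quotient_dim (supported_series D) (supported_series E :: 'k::field fls set) =
    card (D - E)"
proof -
  define t :: "int \<Rightarrow> 'k fls" where "t i = fls_X ^ nat i" for i
  have t: "t i $$ n = (if n = i then 1 else 0)" if "i \<in> D" for i n
    using that nonneg unfolding t_def by auto
  have inj: "inj_on t D" by (rule inj_onI) (metis t zero_neq_one)
  define B where "B = t ` (D - E)"
  have "inj_on t (D - E)" using inj by (rule inj_on_subset) blast
  then have card: "card B = card (D - E)" unfolding B_def by (rule card_image)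
  have BD: "B \<subseteq> supported_series D"
    unfolding B_def supported_series_def using t by (auto split: if_splits)
  have "fls.quotient_basis (supported_series D) (supported_series E) B"
    unfolding fls.quotient_basis_def
  proof (intro conjI allI impI)
    show "B \<subseteq> supported_series D" by (fact BD)
  next
    fix T c
    assume T: "finite T" "T \<subseteq> B" and sum: "(\<Sum>v\<in>T. fls_const (c v) * v) \<in> supported_series E"
    show "\<forall>v\<in>T. c v = 0"
    proof
      fix v assume v: "v \<in> T"
      then obtain i where i: "i \<in> D" "i \<notin> E" "v = t i" using T(2) unfolding B_def by blast
      have "w $$ i = (if w = v then 1 else 0)" if w: "w \<in> T" for w
      proof -
        obtain j where "j \<in> D" "w = t j" using T(2) w unfolding B_def by blast
        then show ?thesis using i t inj by (auto simp: inj_on_eq_iff)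
      qed
      then have "(\<Sum>w\<in>T. fls_const (c w) * w) $$ i = (\<Sum>w\<in>T. if w = v then c w else 0)"
        unfolding fls_nth_sum by (intro sum.cong) auto
      also have "\<dots> = c v" using T(1) v by simp
      finally show "c v = 0" using sum i(2) by (metis supported_seriesD)
    qed
  next
    show "supported_series D = {b + w | b w. b \<in> fls.span B \<and> w \<in> supported_series E}"
    proof (intro equalityI subsetI)
      fix f :: "'k fls" assume f: "f \<in> supported_series D"
      define b where "b = (\<Sum>i\<in>D - E. fls_const (f $$ i) * t i)"
      have "b $$ n = (\<Sum>i\<in>D - E. if i = n then f $$ i else 0)" for n
        unfolding b_def fls_nth_sum by (intro sum.cong) (auto simp: t)
      then have b: "b $$ n = (if n \<in> D - E then f $$ n else 0)" for n using fin by simp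
      have "b \<in> fls.span B"
        unfolding b_def B_def by (intro fls.span_sum fls.span_scale fls.span_base) blast
      moreover have "f - b \<in> supported_series E"
        using f unfolding supported_series_def by (auto simp: b split: if_splits)
      ultimately show "f \<in> {b + w | b w. b \<in> fls.span B \<and> w \<in> supported_series E}"
        by (intro CollectI exI[of _ b] exI[of _ "f - b"]) simp
    next
      fix f :: "'k fls"
      assume "f \<in> {b + w | b w. b \<in> fls.span B \<and> w \<in> supported_series E}"
      then obtain b w where f: "f = b + w" "b \<in> fls.span B" "w \<in> supported_series E" by blast
      have "b \<in> supported_series D"
        using fls.span_minimal[OF BD supported_series_subspace] f(2) by blast
      moreover have "w \<in> supported_series D" using f(3) supported_series_mono[OF E] by blast
      ultimately show "f \<in> supported_series D"
        unfolding f(1) by (rule fls.subspace_add[OF supported_series_subspace])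
    qed
  qed
  from fls.quotient_dim_eq[OF supported_series_subspace this]
  show ?thesis using card fin unfolding B_def by simp
qed


section \<open>Invariants of the semigroup ring\<close>

lemma fps_to_fls_regpart_supported:
  fixes f :: "'k::field fls"
  assumes "f \<in> supported_series (int ` S)"
  shows "fps_to_fls (fls_regpart f) = f"
proof (rule fls_regpart_to_fls_trivial)
  show "0 \<le> fls_subdegree f"
  proof (cases "f = 0")
    case False
    from supported_seriesD[OF assms nth_fls_subdegree_nonzero[OF this]] show ?thesis by auto
  qed simp
qed

lemma semigroup_ring_supported:
  assumes "numerical_semigroup S"
  shows "semigroup_ring S = (supported_series (int ` S) :: 'k::field fls set)"
  unfolding semigroup_ring_eq[OF assms]
proof (intro equalityI subsetI)
  fix g :: "'k fls"
  assume "g \<in> fps_to_fls ` {f. \<forall>n. n \<notin> S \<longrightarrow> fps_nth f n = 0}"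
  then obtain f where f: "g = fps_to_fls f" "\<And>n. n \<notin> S \<Longrightarrow> fps_nth f n = 0" by blast
  have "n \<in> int ` S" if "g $$ n \<noteq> 0" for n
  proof -
    have "0 \<le> n" "nat n \<in> S" using that f(2)[of "nat n"] unfolding f(1) by (auto split: if_splits)
    then show ?thesis by (metis image_eqI nat_0_le)
  qed
  then show "g \<in> supported_series (int ` S)" unfolding supported_series_def by blast
next
  fix g :: "'k fls" assume g: "g \<in> supported_series (int ` S)"
  have "fps_to_fls (fls_regpart g) = g" using g by (rule fps_to_fls_regpart_supported)
  moreover have "fps_nth (fls_regpart g) n = 0" if "n \<notin> S" for n
    using supported_series_nth_eq_0[OF g, of "int n"] that by (simp add: image_iff)
  ultimately show "g \<in> fps_to_fls ` {f. \<forall>n. n \<notin> S \<longrightarrow> fps_nth f n = 0}"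
    by (intro image_eqI[of g _ "fls_regpart g"]) simp_all
qed

lemma principal_ideal_fls_X_power:
  "principal_ideal (fls_X ^ m) (supported_series E) =
    (supported_series ((+) (int m) ` E) :: 'k::field fls set)"
proof (intro equalityI subsetI)
  fix f :: "'k fls" assume "f \<in> principal_ideal (fls_X ^ m) (supported_series E)"
  then obtain a where a: "f = fls_X ^ m * a" "a \<in> supported_series E"
    unfolding principal_ideal_def by blast
  show "f \<in> supported_series ((+) (int m) ` E)"
    unfolding a(1) mult_fls_X_power_supported_iff using a(2)
    by (auto simp: image_iff add.commute dest: supported_seriesD)
next
  fix f :: "'k fls" assume f: "f \<in> supported_series ((+) (int m) ` E)"
  have "fls_shift (int m) f \<in> supported_series E"
    using f unfolding supported_series_def by auto
  moreover have "f = fls_X ^ m * fls_shift (int m) f"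
    by (simp add: fls_eq_iff fls_X_power_times_nth)
  ultimately show "f \<in> principal_ideal (fls_X ^ m) (supported_series E)"
    unfolding principal_ideal_def by blast
qed

text \<open>In the product of a series and its inverse, the first coefficient of the inverse at a gap
  could not be cancelled, since a gap is never a sum of two elements of the semigroup.\<close>

lemma unit_in_semigroup_ring:
  fixes a :: "'k::field fls"
  assumes S: "submonoid S" and a: "a \<in> supported_series (int ` S)" "a $$ 0 \<noteq> 0"
  shows "\<exists>b\<in>supported_series (int ` S). a * b = 1"
proof -
  define f where "f = fls_regpart a"
  have fa: "fps_to_fls f = a" unfolding f_def using a(1) by (rule fps_to_fls_regpart_supported)
  have f: "fps_nth f n = 0" if "n \<notin> S" for n
    using supported_series_nth_eq_0[OF a(1), of "int n"] that unfolding f_def by (simp add: image_iff)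
  have f0: "fps_nth f 0 \<noteq> 0" using a(2) unfolding f_def by simp
  define g where "g = inverse f"
  have fg: "f * g = 1" unfolding g_def using inverse_mult_eq_1'[OF f0] by simp
  have g: "fps_nth g n = 0" if "n \<notin> S" for n
    using that
  proof (induction n rule: less_induct)
    case (less n)
    have "fps_nth f i * fps_nth g (n - i) = 0" if i: "i \<in> {Suc 0..n}" for i
    proof (cases "i \<in> S")
      case True
      have "n - i \<notin> S"
      proof
        assume "n - i \<in> S"
        with True have "i + (n - i) \<in> S" using S unfolding submonoid_def by blast
        with i less.prems show False by simp
      qed
      then show ?thesis using less.IH[of "n - i"] i by simp
    qed (simp add: f)
    then have "(\<Sum>i = Suc 0..n. fps_nth f i * fps_nth g (n - i)) = 0" by (rule sum.neutral[OF ballI])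
    then have "fps_nth (f * g) n = fps_nth f 0 * fps_nth g n"
      unfolding fps_mult_nth by (simp add: sum.atLeast_Suc_atMost)
    moreover have "fps_nth (f * g) n = 0"
      using less.prems S unfolding fg submonoid_def by (auto intro: gr0I)
    ultimately show ?case using f0 by simp
  qed
  have "n \<in> int ` S" if "fps_to_fls g $$ n \<noteq> 0" for n
  proof -
    have "0 \<le> n" "nat n \<in> S" using that g[of "nat n"] by (auto split: if_splits)
    then show ?thesis by (metis image_eqI nat_0_le)
  qed
  then have "fps_to_fls g \<in> supported_series (int ` S)" unfolding supported_series_def by blast
  moreover have "a * fps_to_fls g = 1"
    unfolding fa[symmetric] fls_times_fps_to_fls[symmetric] fg by simp
  ultimately show ?thesis by blast
qed

lemma nonunits_semigroup_ring:
  assumes S: "submonoid S"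
  shows "nonunits (supported_series (int ` S)) =
    (supported_series (int ` (S - {0})) :: 'k::field fls set)"
proof (intro equalityI subsetI)
  fix a :: "'k fls" assume "a \<in> nonunits (supported_series (int ` S))"
  then have a: "a \<in> supported_series (int ` S)"
    and nonunit: "\<And>b. b \<in> supported_series (int ` S) \<Longrightarrow> a * b \<noteq> 1"
    unfolding nonunits_def by simp_all
  have a0: "a $$ 0 = 0"
  proof (rule ccontr)
    assume "a $$ 0 \<noteq> 0"
    then obtain b where "b \<in> supported_series (int ` S)" "a * b = 1"
      using unit_in_semigroup_ring[OF S a] by auto
    then show False using nonunit by simp
  qed
  have "n \<in> int ` (S - {0})" if n: "a $$ n \<noteq> 0" for n
  proof -
    have "n \<noteq> 0" using n a0 by metis
    moreover obtain s where "s \<in> S" "n = int s" using supported_seriesD[OF a n] by blast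
    ultimately show ?thesis by simp
  qed
  then show "a \<in> supported_series (int ` (S - {0}))" unfolding supported_series_def by blast
next
  fix a :: "'k fls" assume a: "a \<in> supported_series (int ` (S - {0}))"
  have "a * b \<noteq> 1" if b: "b \<in> supported_series (int ` S)" for b
  proof
    assume one: "a * b = 1"
    have "a * b \<in> supported_series {1..}" by (rule mult_supported_series[OF a b]) auto
    then have "(a * b) $$ 0 = 0" by (rule supported_series_nth_eq_0) simp
    then show False unfolding one by simp
  qed
  moreover have "a \<in> supported_series (int ` S)"
    using a supported_series_mono[of "int ` (S - {0})" "int ` S"] by blast
  ultimately show "a \<in> nonunits (supported_series (int ` S))" unfolding nonunits_def by blast
qed

text \<open>The socle is spanned by the monomials \<open>t\<^bsup>f + m\<^esup>\<close>, where \<open>f\<close> is a pseudo-Frobenius number.\<close>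

lemma cm_type_eq_card_pseudo_frobenius:
  assumes S: "numerical_semigroup S"
  shows "cm_type (semigroup_ring S :: 'k::field fls set) (fls_X ^ semigroup_multiplicity S) =
    card (pseudo_frobenius S)"
proof -
  define m where "m = semigroup_multiplicity S"
  have m: "m \<in> S - {0}" unfolding m_def by (rule semigroup_multiplicity_in[OF S])
  have sub: "submonoid S" using S unfolding numerical_semigroup_def by blast
  define I where "I = (+) (int m) ` int ` S"
  define D where "D = {i \<in> int ` S. \<forall>s\<in>S - {0}. i + int s \<in> I}"
  have I_iff: "i \<in> I \<longleftrightarrow> i - int m \<in> int ` S" for i unfolding I_def by force
  have "{a \<in> supported_series (int ` S). \<forall>b\<in>supported_series (int ` (S - {0})).
      a * b \<in> supported_series I} = (supported_series D :: 'k fls set)" (is "?L = _")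
  proof (intro equalityI subsetI)
    fix a :: "'k fls" assume a: "a \<in> ?L"
    have "i \<in> D" if i: "a $$ i \<noteq> 0" for i
    proof -
      have "i + int s \<in> I" if s: "s \<in> S - {0}" for s
      proof -
        have "fls_X ^ s \<in> (supported_series (int ` (S - {0})) :: 'k fls set)"
          unfolding fls_X_power_in_supported_series using s by blast
        then have "a * fls_X ^ s \<in> supported_series I" using a by blast
        then have "fls_X ^ s * a \<in> supported_series I" by (subst mult.commute)
        then show ?thesis unfolding mult_fls_X_power_supported_iff using i by blast
      qed
      then show ?thesis unfolding D_def using a i by (auto dest: supported_seriesD)
    qed
    then show "a \<in> supported_series D" unfolding supported_series_def by blast
  next
    fix a :: "'k fls" assume a: "a \<in> supported_series D"
    then have "a \<in> supported_series (int ` S)"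
      using supported_series_mono[of D "int ` S"] unfolding D_def by blast
    moreover have "a * b \<in> supported_series I" if "b \<in> supported_series (int ` (S - {0}))" for b
      by (rule mult_supported_series[OF a that]) (auto simp: D_def)
    ultimately show "a \<in> ?L" by blast
  qed
  then have "cm_type (semigroup_ring S :: 'k fls set) (fls_X ^ m) =
      fls_quotient_dim (supported_series D) (supported_series I :: 'k fls set)"
    unfolding cm_type_def semigroup_ring_supported[OF S] nonunits_semigroup_ring[OF sub]
      principal_ideal_fls_X_power I_def by simp
  also have DI: "D - I = (+) (int m) ` pseudo_frobenius S"
  proof (intro equalityI subsetI)
    fix i assume i: "i \<in> D - I"
    have "i - int m + int s \<in> int ` S" if "s \<in> S - {0}" for s
      using i that unfolding D_def I_iff by (simp add: algebra_simps)
    moreover have "i - int m \<notin> int ` S" using i I_iff by blast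
    ultimately have "i - int m \<in> pseudo_frobenius S" unfolding pseudo_frobenius_def by blast
    then show "i \<in> (+) (int m) ` pseudo_frobenius S" by force
  next
    fix i assume "i \<in> (+) (int m) ` pseudo_frobenius S"
    then obtain f where i: "i = f + int m" and "f \<in> pseudo_frobenius S" by force
    then have "f \<notin> int ` S" and f: "\<And>s. s \<in> S - {0} \<Longrightarrow> f + int s \<in> int ` S"
      unfolding pseudo_frobenius_def by blast+
    then have "i \<notin> I" unfolding I_iff i by simp
    moreover have "i \<in> D" unfolding D_def I_iff i using f m by (simp add: algebra_simps)
    ultimately show "i \<in> D - I" by blast
  qed
  then have "fls_quotient_dim (supported_series D) (supported_series I :: 'k fls set) =
      card (D - I)"
  proof (intro quotient_dim_supported_series)
    show "I \<subseteq> D"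
    proof
      fix i assume "i \<in> I"
      then have i: "i - int m \<in> int ` S" unfolding I_iff .
      have "i - int m + int m \<in> int ` S"
        using m by (intro int_image_submonoid(2)[OF sub] i) blast
      moreover have "i + int s - int m \<in> int ` S" if "s \<in> S - {0}" for s
        using int_image_submonoid(2)[OF sub i, of "int s"] that by (simp add: algebra_simps)
      ultimately show "i \<in> D" unfolding D_def I_iff by simp
    qed
    show "finite (D - I)" unfolding DI by (intro finite_imageI finite_pseudo_frobenius[OF S])
    show "D \<subseteq> {0..}" unfolding D_def by auto
  qed
  also have "\<dots> = card (pseudo_frobenius S)" unfolding DI by (rule card_image) (simp add: inj_on_def)
  finally show ?thesis unfolding m_def .
qed

text \<open>A large power of \<open>t\<close> lies in the ring and moves the support of any given series above \<open>F\<close>, hence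
  into \<open>S\<close>.\<close>

lemma quotient_field_semigroup_ring:
  assumes S: "numerical_semigroup S"
  shows "quotient_field (semigroup_ring S :: 'k::field fls set) = UNIV"
proof -
  have "z \<in> quotient_field (supported_series (int ` S))" for z :: "'k fls"
  proof -
    define N where "N = nat (\<bar>frobenius_number S\<bar> + \<bar>fls_subdegree z\<bar> + 1)"
    have "n + int N \<in> int ` S" if "z $$ n \<noteq> 0" for n
    proof -
      have "fls_subdegree z \<le> n" using that by (meson fls_eq0_below_subdegree not_le)
      then show ?thesis by (intro above_frobenius_number[OF S]) (auto simp: N_def)
    qed
    then have num: "fls_X ^ N * z \<in> supported_series (int ` S)"
      unfolding mult_fls_X_power_supported_iff by blast
    have den: "(fls_X ^ N :: 'k fls) \<in> supported_series (int ` S)"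
      unfolding fls_X_power_in_supported_series
      by (intro above_frobenius_number[OF S]) (auto simp: N_def)
    have X: "(fls_X ^ N :: 'k fls) \<noteq> 0" by simp
    then have "z = (fls_X ^ N * z) / fls_X ^ N"
      using nonzero_mult_div_cancel_left[of "fls_X ^ N" z] by metis
    with num den X show ?thesis unfolding quotient_field_def by blast
  qed
  then show ?thesis unfolding semigroup_ring_supported[OF S] by blast
qed

text \<open>If \<open>z\<close> has negative order \<open>d\<close>, then in a monic equation of degree \<open>q\<close> the term \<open>z\<^sup>q\<close> is the only
  one of order \<open>qd\<close>, all others having larger order.\<close>

lemma integral_closure_nonneg:
  fixes R :: "'k::field fls set"
  assumes R: "R \<subseteq> supported_series {0..}"
  shows "integral_closure R \<subseteq> supported_series {0..}"
proof
  fix z assume "z \<in> integral_closure R"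
  then obtain p where p: "lead_coeff p = 1" "\<And>i. poly.coeff p i \<in> R" "poly p z = 0"
    unfolding integral_closure_def by blast
  define d where "d = fls_subdegree z"
  define q where "q = degree p"
  have "0 \<le> d"
  proof (rule ccontr)
    assume "\<not> 0 \<le> d"
    then have z: "z \<noteq> 0" unfolding d_def by auto
    have "(poly.coeff p i * z ^ i) $$ (int q * d) = 0" if "i < q" for i
    proof (rule fls_times_nth_eq0)
      have coeff: "poly.coeff p i \<in> supported_series {0..}" using p(2) R by blast
      have "0 \<le> fls_subdegree (poly.coeff p i)"
      proof (cases "poly.coeff p i = 0")
        case False
        from supported_seriesD[OF coeff nth_fls_subdegree_nonzero[OF this]] show ?thesis by simp
      qed simp
      moreover have "int q * d < int i * d" using that \<open>\<not> 0 \<le> d\<close> by simp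
      ultimately show "int q * d < fls_subdegree (poly.coeff p i) + fls_subdegree (z ^ i)"
        by (simp add: fls_subdegree_pow d_def)
    qed
    then have "poly p z $$ (int q * d) = (z ^ q) $$ (int q * d)"
      using p(1) unfolding poly_altdef fls_nth_sum q_def[symmetric]
      by (simp add: lessThan_Suc_atMost[symmetric])
    also have "\<dots> \<noteq> 0"
      using z nth_fls_subdegree_nonzero[of "z ^ q"] by (simp add: fls_subdegree_pow d_def)
    finally show False using p(3) by simp
  qed
  then show "z \<in> supported_series {0..}"
    unfolding supported_series_def d_def
    by (auto, metis fls_eq0_below_subdegree linorder_not_less order.trans)
qed

text \<open>If \<open>N > 0\<close> lies in \<open>S\<close>, then \<open>t\<^sup>i\<close> is a root of \<open>y\<^sup>N - t\<^bsup>iN\<^esup>\<close>. Together with the preceding bound, these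
  elements suffice to compute the conductor.\<close>

lemma fls_X_power_integral:
  assumes S: "numerical_semigroup S"
  shows "fls_X ^ i \<in> integral_closure (semigroup_ring S :: 'k::field fls set)"
proof -
  define N where "N = nat (\<bar>frobenius_number S\<bar> + 1)"
  have sub: "submonoid S" using S unfolding numerical_semigroup_def by blast
  have N: "int N \<in> int ` S" "N > 0"
    unfolding N_def by (auto intro!: above_frobenius_number[OF S])
  define a :: "'k fls" where "a = fls_X ^ (i * N)"
  define p where "p = Polynomial.monom 1 N - [:a:]"
  have "int (i * N) \<in> int ` S"
    using int_image_submonoid_mult[OF sub N(1), of "int i"] by simp
  then have a: "- a \<in> supported_series (int ` S)"
    unfolding a_def using fls_X_power_in_supported_series[of "i * N" "int ` S", where ?'k='k]
    by (metis fls.subspace_neg supported_series_subspace)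
  have 1: "(1 :: 'k fls) \<in> supported_series (int ` S)"
    using fls_X_power_in_supported_series[of 0] int_image_submonoid(1)[OF sub] by auto
  have 0: "(0 :: 'k fls) \<in> supported_series (int ` S)"
    by (rule fls.subspace_0[OF supported_series_subspace])
  have coeff: "poly.coeff p j = (if j = N then 1 else if j = 0 then - a else 0)" for j
    unfolding p_def using N(2) by (cases j) auto
  have "degree p = N"
    by (rule antisym[OF degree_le le_degree]) (auto simp: coeff)
  then have "lead_coeff p = 1" by (simp add: coeff)
  moreover have "poly.coeff p j \<in> supported_series (int ` S)" for j using 0 1 a by (simp add: coeff)
  moreover have "poly p (fls_X ^ i) = 0"
    unfolding p_def a_def by (simp add: poly_monom power_mult)
  ultimately show ?thesis
    unfolding integral_closure_def quotient_field_semigroup_ring[OF S]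
    unfolding semigroup_ring_supported[OF S] by blast
qed

text \<open>If \<open>z\<close> lies in the conductor and \<open>t\<^sup>n\<close> occurs in \<open>z\<close>, then \<open>t\<^bsup>n + i\<^esup>\<close> occurs in \<open>z t\<^sup>i \<in> k[[S]]\<close> for every
  \<open>i \<ge> 0\<close>. Thus \<open>S\<close> contains everything from \<open>n\<close> on, and \<open>n > F\<close>.\<close>

lemma conductor_semigroup_ring:
  assumes S: "numerical_semigroup S"
  shows "conductor (semigroup_ring S) =
    (supported_series {frobenius_number S<..} :: 'k::field fls set)"
proof (intro equalityI subsetI)
  fix z :: "'k fls" assume z: "z \<in> conductor (semigroup_ring S)"
  have "frobenius_number S < n" if n: "z $$ n \<noteq> 0" for n
  proof -
    have "w \<in> int ` S" if w: "n - 1 < w" for w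
    proof -
      have "z * fls_X ^ nat (w - n) \<in> semigroup_ring S"
        using z fls_X_power_integral[OF S] unfolding conductor_def by blast
      then have "n + int (nat (w - n)) \<in> int ` S"
        using n unfolding semigroup_ring_supported[OF S] mult.commute[of z]
          mult_fls_X_power_supported_iff by blast
      then show ?thesis using w by simp
    qed
    then have "frobenius_number S \<le> n - 1" by (rule frobenius_number_le)
    then show ?thesis by simp
  qed
  then show "z \<in> supported_series {frobenius_number S<..}" unfolding supported_series_def by simp
next
  fix z :: "'k fls" assume z: "z \<in> supported_series {frobenius_number S<..}"
  have "z * y \<in> semigroup_ring S" if "y \<in> integral_closure (semigroup_ring S)" for y
  proof -
    have "(semigroup_ring S :: 'k fls set) \<subseteq> supported_series {0..}"
      unfolding semigroup_ring_supported[OF S] by (intro supported_series_mono) auto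
    then have y: "y \<in> supported_series {0..}" using integral_closure_nonneg that by blast
    show ?thesis
      unfolding semigroup_ring_supported[OF S]
      by (rule mult_supported_series[OF z y]) (auto intro!: above_frobenius_number[OF S])
  qed
  then show "z \<in> conductor (semigroup_ring S)"
    unfolding conductor_def quotient_field_semigroup_ring[OF S] by blast
qed

text \<open>With \<open>C\<close> the conductor and \<open>R\<close> the ring, a basis exponent of \<open>(C + t\<^sup>m R) / t\<^sup>m R\<close> exceeds \<open>F\<close> and leaves \<open>S\<close> when \<open>m\<close> is subtracted.\<close>

lemma reduced_type_eq_card_large_gaps:
  assumes S: "numerical_semigroup S"
  shows "reduced_type (semigroup_ring S :: 'k::field fls set) (fls_X ^ semigroup_multiplicity S) =
    card ({frobenius_number S - int (semigroup_multiplicity S)<..} - int ` S)"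
proof -
  define m where "m = semigroup_multiplicity S"
  define F where "F = frobenius_number S"
  define I where "I = (+) (int m) ` int ` S"
  let ?G = "{F - int m<..} - int ` S"
  have I_iff: "i \<in> I \<longleftrightarrow> i - int m \<in> int ` S" for i unfolding I_def by force
  have "-1 \<le> F" unfolding F_def frobenius_number_def by simp
  have "reduced_type (semigroup_ring S :: 'k fls set) (fls_X ^ m) =
      fls_quotient_dim (supported_series ({F<..} \<union> I)) (supported_series I :: 'k fls set)"
    unfolding reduced_type_def conductor_semigroup_ring[OF S]
    unfolding semigroup_ring_supported[OF S]
      principal_ideal_fls_X_power F_def[symmetric] I_def[symmetric]
    by (subst supported_series_sum[of _ F]) auto
  also have diff: "{F<..} \<union> I - I = (+) (int m) ` ?G"
  proof (intro equalityI subsetI)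
    fix i assume "i \<in> {F<..} \<union> I - I"
    then have "i - int m \<in> ?G" by (auto simp: I_iff)
    then show "i \<in> (+) (int m) ` ?G" by force
  qed (auto simp: I_iff)
  then have "fls_quotient_dim (supported_series ({F<..} \<union> I)) (supported_series I :: 'k fls set) =
      card ({F<..} \<union> I - I)"
  proof (intro quotient_dim_supported_series)
    have "?G \<subseteq> pseudo_frobenius S"
      using large_gap_pseudo_frobenius[OF S] unfolding F_def m_def by blast
    then show "finite ({F<..} \<union> I - I)"
      unfolding diff using finite_pseudo_frobenius[OF S] finite_subset by blast
    show "{F<..} \<union> I \<subseteq> {0..}" using \<open>-1 \<le> F\<close> unfolding I_def by auto
  qed blast
  also have "\<dots> = card ?G" unfolding diff by (rule card_image) (simp add: inj_on_def)
  finally show ?thesis unfolding F_def m_def .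
qed

text \<open>Both invariants are cardinalities of finite sets, one contained in the other, so they agree
  precisely when the sets do.\<close>

lemma maximal_reduced_type_iff:
  assumes S: "numerical_semigroup S"
  shows "maximal_reduced_type TYPE('k::field) S \<longleftrightarrow>
    (\<forall>f\<in>pseudo_frobenius S. frobenius_number S - int (semigroup_multiplicity S) < f)"
proof -
  let ?G = "{frobenius_number S - int (semigroup_multiplicity S)<..} - int ` S"
  have G: "?G \<subseteq> pseudo_frobenius S" using large_gap_pseudo_frobenius[OF S] by blast
  have "maximal_reduced_type TYPE('k) S \<longleftrightarrow> card ?G = card (pseudo_frobenius S)"
    unfolding maximal_reduced_type_def Let_def reduced_type_eq_card_large_gaps[OF S]
      cm_type_eq_card_pseudo_frobenius[OF S] ..
  also have "\<dots> \<longleftrightarrow> pseudo_frobenius S \<subseteq> ?G"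
    using card_subset_eq[OF finite_pseudo_frobenius[OF S] G] G by (metis equalityE subset_antisym)
  also have "\<dots> \<longleftrightarrow>
      (\<forall>f\<in>pseudo_frobenius S. frobenius_number S - int (semigroup_multiplicity S) < f)"
    unfolding pseudo_frobenius_def by auto
  finally show ?thesis .
qed


section \<open>Gluings\<close>

lemma submonoid_hull_image_mult:
  assumes "a \<in> submonoid hull A" "(\<lambda>a. l * a) ` A \<subseteq> T" "submonoid T"
  shows "l * a \<in> T"
  using assms(1)
proof (rule hull_induct)
  show "l * a \<in> T" if "a \<in> A" for a using that assms(2) by blast
  show "submonoid {a. l * a \<in> T}"
    using assms(3) unfolding submonoid_def by (auto simp: distrib_left)
qed

lemma glue_eq:
  "glue l m A B = {l * a + m * b | a b. a \<in> submonoid hull A \<and> b \<in> submonoid hull B}" (is "_ = ?T")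
proof (intro equalityI)
  have A: "submonoid (submonoid hull A)" and B: "submonoid (submonoid hull B)" by simp_all
  have "(\<lambda>a. l * a) ` A \<subseteq> ?T"
  proof
    fix x assume "x \<in> (\<lambda>a. l * a) ` A"
    then obtain a where "a \<in> A" "x = l * a + m * 0" by auto
    then show "x \<in> ?T" using B unfolding submonoid_def by (blast intro: hull_inc)
  qed
  moreover have "(\<lambda>b. m * b) ` B \<subseteq> ?T"
  proof
    fix x assume "x \<in> (\<lambda>b. m * b) ` B"
    then obtain b where "b \<in> B" "x = l * 0 + m * b" by auto
    then show "x \<in> ?T" using A unfolding submonoid_def by (blast intro: hull_inc)
  qed
  moreover have "submonoid ?T"
    unfolding submonoid_def[of ?T]
  proof (intro conjI ballI)
    have "0 \<in> submonoid hull A" "0 \<in> submonoid hull B" using A B unfolding submonoid_def by blast+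
    moreover have "0 = l * 0 + m * 0" by simp
    ultimately show "0 \<in> ?T" by blast
  next
    fix x y assume "x \<in> ?T" "y \<in> ?T"
    then obtain a b a' b' where x: "x = l * a + m * b" "a \<in> submonoid hull A" "b \<in> submonoid hull B"
      and y: "y = l * a' + m * b'" "a' \<in> submonoid hull A" "b' \<in> submonoid hull B" by blast
    have "x + y = l * (a + a') + m * (b + b')" unfolding x(1) y(1) by (simp add: distrib_left)
    moreover have "a + a' \<in> submonoid hull A" "b + b' \<in> submonoid hull B"
      using A B x y unfolding submonoid_def by blast+
    ultimately show "x + y \<in> ?T" by blast
  qed
  ultimately show "glue l m A B \<subseteq> ?T" unfolding glue_def by (intro hull_minimal) auto
next
  let ?H = "submonoid hull ((\<lambda>a. l * a) ` A \<union> (\<lambda>b. m * b) ` B)"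
  have sub: "(\<lambda>a. l * a) ` A \<subseteq> ?H" "(\<lambda>b. m * b) ` B \<subseteq> ?H"
    using hull_subset[of "(\<lambda>a. l * a) ` A \<union> (\<lambda>b. m * b) ` B" submonoid] by auto
  have "l * a + m * b \<in> ?H" if "a \<in> submonoid hull A" "b \<in> submonoid hull B" for a b
    using submonoid_hull_image_mult[OF that(1) sub(1)] submonoid_hull_image_mult[OF that(2) sub(2)]
      submonoid_hull[of "(\<lambda>a. l * a) ` A \<union> (\<lambda>b. m * b) ` B"]
    unfolding submonoid_def by blast
  then show "?T \<subseteq> glue l m A B" unfolding glue_def by blast
qed

text \<open>Only the arithmetic of a gluing is kept: \<open>S = l S\<^sub>1 + m S\<^sub>2\<close> with coprime positive \<open>l \<in> S\<^sub>2\<close> and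
  \<open>m \<in> S\<^sub>1\<close>.\<close>

locale glued_semigroups =
  fixes S\<^sub>1 S\<^sub>2 S :: "nat set" and l m :: nat
  assumes S1: "numerical_semigroup S\<^sub>1" and S2: "numerical_semigroup S\<^sub>2"
    and m: "m \<in> S\<^sub>1" "m > 0" and l: "l \<in> S\<^sub>2" "l > 0"
    and coprime: "coprime l m"
    and S: "S = {l * a + m * b | a b. a \<in> S\<^sub>1 \<and> b \<in> S\<^sub>2}"
begin

lemma sub1: "submonoid S\<^sub>1" and sub2: "submonoid S\<^sub>2"
  using S1 S2 unfolding numerical_semigroup_def by blast+

lemma in_S_iff:
  "z \<in> int ` S \<longleftrightarrow> (\<exists>a\<in>int ` S\<^sub>1. \<exists>b\<in>int ` S\<^sub>2. z = int l * a + int m * b)"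
proof
  assume "z \<in> int ` S"
  then obtain a b where "a \<in> S\<^sub>1" "b \<in> S\<^sub>2" "z = int (l * a + m * b)" unfolding S by blast
  then show "\<exists>a\<in>int ` S\<^sub>1. \<exists>b\<in>int ` S\<^sub>2. z = int l * a + int m * b"
    by (intro bexI[of _ "int a"] bexI[of _ "int b"]) auto
next
  assume "\<exists>a\<in>int ` S\<^sub>1. \<exists>b\<in>int ` S\<^sub>2. z = int l * a + int m * b"
  then obtain a b where "a \<in> S\<^sub>1" "b \<in> S\<^sub>2" "z = int (l * a + m * b)" by auto
  then show "z \<in> int ` S" unfolding S by blast
qed

lemma same_value:
  assumes "int l * a + int m * b = int l * a' + int m * b'"
  obtains k where "a' = a + int m * k" "b = b' + int l * k"
proof -
  have eq: "int l * (a' - a) = int m * (b - b')" using assms by (simp add: algebra_simps)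
  then have "int m dvd int l * (a' - a)" by simp
  then have "int m dvd a' - a"
    using coprime coprime_commute coprime_dvd_mult_right_iff coprime_int_iff by blast
  then obtain k where k: "a' - a = int m * k" ..
  from eq have "int m * (int l * k) = int m * (b - b')" unfolding k by (simp add: ac_simps)
  then have "b - b' = int l * k" using m(2) by simp
  with k show thesis by (intro that[of k]) auto
qed

text \<open>In \<open>z = l a + m b\<close> the integer \<open>a\<close> is determined modulo \<open>m\<close> and can be moved freely in its class.\<close>

lemma representation_in_residue_class:
  obtains a b where "z = int l * a + int m * b" "x \<le> a" "a < x + int m"
proof -
  have "gcd (int l) (int m) = 1" using coprime by simp
  then obtain u w where "u * int l + w * int m = 1" by (metis bezout_int)
  then have v: "int l * u - 1 = int m * (- w)" by (simp add: algebra_simps)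
  define a where "a = x + (z * u - x) mod int m"
  define q where "q = (z * u - x) div int m"
  have "z * u = a + int m * q" unfolding a_def q_def by (simp add: mult_div_mod_eq)
  then have "int l * a = int l * (z * u - int m * q)" by simp
  also have "\<dots> = z * (1 + int m * (- w)) - int l * int m * q" 
    unfolding v[symmetric] by (simp add: algebra_simps)
  finally have "z = int l * a + int m * (int l * q + z * w)" by (simp add: algebra_simps)
  moreover have "x \<le> a" "a < x + int m" unfolding a_def using m(2) by simp_all
  ultimately show thesis by (rule that)
qed

text \<open>Choosing \<open>a\<close> among the first \<open>m\<close> integers above \<open>F(S\<^sub>1)\<close> leaves enough for \<open>b\<close> to exceed \<open>F(S\<^sub>2)\<close>.\<close>

lemma above_bound_in_glued:
  assumes z: "int l * frobenius_number S\<^sub>1 + int m * frobenius_number S\<^sub>2 + int l * int m < z"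
  shows "z \<in> int ` S"
proof -
  obtain a b where ab: "z = int l * a + int m * b" "frobenius_number S\<^sub>1 + 1 \<le> a"
    "a < frobenius_number S\<^sub>1 + 1 + int m"
    by (rule representation_in_residue_class)
  have "int l * a \<le> int l * (frobenius_number S\<^sub>1 + int m)" using ab(3) by (intro mult_left_mono) auto
  then have "int m * frobenius_number S\<^sub>2 < int m * b"
    using z unfolding ab(1) by (simp add: distrib_left)
  then have "frobenius_number S\<^sub>2 < b" using m(2) by simp
  then show ?thesis
    unfolding in_S_iff using ab above_frobenius_number[OF S1, of a] above_frobenius_number[OF S2, of b]
    by auto
qed

lemma numerical_semigroup_glued: "numerical_semigroup S"
  unfolding numerical_semigroup_def
proof
  let ?U = "int l * frobenius_number S\<^sub>1 + int m * frobenius_number S\<^sub>2 + int l * int m"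
  show "submonoid S"
    unfolding submonoid_def
  proof (intro conjI ballI)
    have "0 = l * 0 + m * 0" by simp
    then show "0 \<in> S" unfolding S using sub1 sub2 unfolding submonoid_def by blast
  next
    fix x y assume "x \<in> S" "y \<in> S"
    then obtain a b a' b' where *: "x = l * a + m * b" "y = l * a' + m * b'"
      "a \<in> S\<^sub>1" "b \<in> S\<^sub>2" "a' \<in> S\<^sub>1" "b' \<in> S\<^sub>2" unfolding S by blast
    have "x + y = l * (a + a') + m * (b + b')" unfolding * by (simp add: distrib_left)
    moreover have "a + a' \<in> S\<^sub>1" "b + b' \<in> S\<^sub>2" using * sub1 sub2 unfolding submonoid_def by blast+
    ultimately show "x + y \<in> S" unfolding S by blast
  qed
  have "x \<in> S" if "nat (?U + 1) \<le> x" for x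
    using above_bound_in_glued[of "int x"] that by (auto simp: image_iff)
  then have "{nat (?U + 1)..} \<subseteq> S" by auto
  then show "finite (UNIV - S)" unfolding cofinite_iff_contains_tail by blast
qed

text \<open>Write \<open>p = l a + m b\<close> with \<open>a \<in> S\<^sub>1\<close> and \<open>a - m \<notin> S\<^sub>1\<close>; then \<open>f = a - m\<close> and \<open>g = b\<close>. Indeed \<open>b \<notin> S\<^sub>2\<close>, since
  \<open>p \<notin> S\<close>. Adding \<open>m s\<close> or \<open>l s\<close> to \<open>p\<close> leads into \<open>S\<close>, and any two representations of the same number
  differ by a multiple of \<open>(m, -l)\<close>. The sign of this multiple is forced by \<open>a - m \<notin> S\<^sub>1\<close> in the first case
  and by \<open>b \<notin> S\<^sub>2\<close> in the second; as \<open>l \<in> S\<^sub>2\<close> and \<open>m \<in> S\<^sub>1\<close>, the shift stays inside the semigroup.\<close>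

lemma pseudo_frobenius_glued:
  assumes p: "p \<in> pseudo_frobenius S"
  obtains f g where "f \<in> pseudo_frobenius S\<^sub>1" "g \<in> pseudo_frobenius S\<^sub>2"
    "p = int l * f + int m * g + int l * int m"
proof -
  have pS: "p \<notin> int ` S" "\<And>s. s \<in> S \<Longrightarrow> s \<noteq> 0 \<Longrightarrow> p + int s \<in> int ` S"
    using p unfolding pseudo_frobenius_def by auto
  have m1: "int m \<in> int ` S\<^sub>1" and l2: "int l \<in> int ` S\<^sub>2" using m l by blast+
  \<comment> \<open>The first coordinate is the least element of \<open>S\<^sub>1\<close> in its residue class modulo \<open>m\<close>.\<close>
  obtain a b where ab: "p = int l * a + int m * b" "a \<in> int ` S\<^sub>1" "a - int m \<notin> int ` S\<^sub>1"
  proof -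
    define P where "P = (\<lambda>i. \<exists>b. int i \<in> int ` S\<^sub>1 \<and> p = int l * int i + int m * b)"
    obtain a0 b0 where a0: "p = int l * a0 + int m * b0" "frobenius_number S\<^sub>1 + 1 \<le> a0"
      by (rule representation_in_residue_class)
    have "a0 \<in> int ` S\<^sub>1" using a0 by (intro above_frobenius_number[OF S1]) simp
    then obtain i where i: "a0 = int i" by blast
    have "P i" unfolding P_def i[symmetric] using a0(1) \<open>a0 \<in> int ` S\<^sub>1\<close> by blast
    then have least: "P (LEAST i. P i)" by (rule LeastI)
    then obtain b where b: "p = int l * int (LEAST i. P i) + int m * b" unfolding P_def by blast
    have "int (LEAST i. P i) - int m \<notin> int ` S\<^sub>1"
    proof
      assume "int (LEAST i. P i) - int m \<in> int ` S\<^sub>1"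
      then obtain j where j: "int (LEAST i. P i) - int m = int j" "int j \<in> int ` S\<^sub>1" by force
      have "p = int l * int j + int m * (b + int l)"
        unfolding j(1)[symmetric] using b by (simp add: algebra_simps)
      then have "P j" unfolding P_def using j(2) by blast
      then have "(LEAST i. P i) \<le> j" by (rule Least_le)
      then show False using j(1) m(2) by simp
    qed
    then show thesis using that[OF b] least unfolding P_def by blast
  qed
  have b: "b \<notin> int ` S\<^sub>2" using pS(1) ab in_S_iff by blast
  have "b \<in> pseudo_frobenius S\<^sub>2"
    unfolding pseudo_frobenius_def
  proof (intro CollectI conjI ballI b)
    fix s assume s: "s \<in> S\<^sub>2 - {0}"
    have "m * s = l * 0 + m * s" "0 \<in> S\<^sub>1" using sub1 unfolding submonoid_def by auto
    then have "m * s \<in> S" "m * s \<noteq> 0" using s m(2) unfolding S by force+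
    from pS(2)[OF this] obtain a' b' where ab': "a' \<in> int ` S\<^sub>1" "b' \<in> int ` S\<^sub>2"
      "p + int (m * s) = int l * a' + int m * b'" unfolding in_S_iff by blast
    then have "int l * a + int m * (b + int s) = int l * a' + int m * b'"
      unfolding ab(1) by (simp add: algebra_simps)
    then obtain k where k: "a' = a + int m * k" "b + int s = b' + int l * k" by (rule same_value)
    have "0 \<le> k"
    proof (rule ccontr)
      assume "\<not> 0 \<le> k"
      then have "a' + (- k - 1) * int m \<in> int ` S\<^sub>1"
        by (intro int_image_submonoid(2)[OF sub1 ab'(1)] int_image_submonoid_mult[OF sub1 m1]) simp
      then show False using ab(3) unfolding k(1) by (simp add: algebra_simps)
    qed
    then have "b' + k * int l \<in> int ` S\<^sub>2"
      by (intro int_image_submonoid(2)[OF sub2 ab'(2)] int_image_submonoid_mult[OF sub2 l2])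
    then show "b + int s \<in> int ` S\<^sub>2" unfolding k(2) by (simp add: mult.commute)
  qed
  moreover have "a - int m \<in> pseudo_frobenius S\<^sub>1"
    unfolding pseudo_frobenius_def
  proof (intro CollectI conjI ballI ab(3))
    fix s assume s: "s \<in> S\<^sub>1 - {0}"
    have "l * s = l * s + m * 0" "0 \<in> S\<^sub>2" using sub2 unfolding submonoid_def by auto
    then have "l * s \<in> S" "l * s \<noteq> 0" using s l(2) unfolding S by force+
    from pS(2)[OF this] obtain a' b' where ab': "a' \<in> int ` S\<^sub>1" "b' \<in> int ` S\<^sub>2"
      "p + int (l * s) = int l * a' + int m * b'" unfolding in_S_iff by blast
    then have "int l * a' + int m * b' = int l * (a + int s) + int m * b"
      unfolding ab(1) by (simp add: algebra_simps)
    then obtain k where k: "a + int s = a' + int m * k" "b' = b + int l * k" by (rule same_value)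
    have "0 < k"
    proof (rule ccontr)
      assume "\<not> 0 < k"
      then have "b' + (- k) * int l \<in> int ` S\<^sub>2"
        by (intro int_image_submonoid(2)[OF sub2 ab'(2)] int_image_submonoid_mult[OF sub2 l2]) simp
      then show False using b unfolding k(2) by (simp add: algebra_simps)
    qed
    then have "a' + (k - 1) * int m \<in> int ` S\<^sub>1"
      by (intro int_image_submonoid(2)[OF sub1 ab'(1)] int_image_submonoid_mult[OF sub1 m1]) simp
    moreover have "a - int m + int s = a' + (k - 1) * int m"
      using k(1) by (simp add: algebra_simps)
    ultimately show "a - int m + int s \<in> int ` S\<^sub>1" by simp
  qed
  ultimately show thesis using ab(1) by (intro that) (auto simp: algebra_simps)
qed

lemma multiplicity_glued:
  "min (l * semigroup_multiplicity S\<^sub>1) (m * semigroup_multiplicity S\<^sub>2) \<le> semigroup_multiplicity S"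
proof -
  obtain a b where ab: "semigroup_multiplicity S = l * a + m * b" "a \<in> S\<^sub>1" "b \<in> S\<^sub>2"
    "a \<noteq> 0 \<or> b \<noteq> 0"
    using semigroup_multiplicity_in[OF numerical_semigroup_glued] unfolding S by force
  show ?thesis
  proof (cases "a = 0")
    case False
    then have "l * semigroup_multiplicity S\<^sub>1 \<le> l * a"
      using semigroup_multiplicity_le[OF ab(2)] by simp
    then show ?thesis unfolding ab(1) by linarith
  next
    case True
    then have "m * semigroup_multiplicity S\<^sub>2 \<le> m * b"
      using semigroup_multiplicity_le[OF ab(3)] ab(4) by simp
    then show ?thesis unfolding ab(1) by linarith
  qed
qed

lemma maximal_reduced_type_glued:
  assumes "maximal_reduced_type TYPE('k::field) S\<^sub>1" "maximal_reduced_type TYPE('k) S\<^sub>2"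
    and large: "max (l * semigroup_multiplicity S\<^sub>1) (m * semigroup_multiplicity S\<^sub>2) < l + m"
  shows "maximal_reduced_type TYPE('k) S"
  unfolding maximal_reduced_type_iff[OF numerical_semigroup_glued]
proof
  fix p assume "p \<in> pseudo_frobenius S"
  then obtain f g where f: "f \<in> pseudo_frobenius S\<^sub>1" and g: "g \<in> pseudo_frobenius S\<^sub>2"
    and p: "p = int l * f + int m * g + int l * int m" by (rule pseudo_frobenius_glued)
  define m1 where "m1 = semigroup_multiplicity S\<^sub>1"
  define m2 where "m2 = semigroup_multiplicity S\<^sub>2"
  define F1 where "F1 = frobenius_number S\<^sub>1"
  define F2 where "F2 = frobenius_number S\<^sub>2"
  have "F1 - int m1 + 1 \<le> f" "F2 - int m2 + 1 \<le> g"
    using assms(1,2) f g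
    unfolding maximal_reduced_type_iff[OF S1] maximal_reduced_type_iff[OF S2] m1_def m2_def F1_def F2_def
    by force+
  then have "int l * (F1 - int m1 + 1) \<le> int l * f" "int m * (F2 - int m2 + 1) \<le> int m * g"
    by (intro mult_left_mono; simp)+
  then have "int l * F1 + int m * F2 + int l * int m + (int l + int m)
      - (int (l * m1) + int (m * m2)) \<le> p"
    unfolding p by (simp add: algebra_simps)
  moreover have "int (l * m1) + int (m * m2) - (int l + int m) < int (semigroup_multiplicity S)"
    using large multiplicity_glued unfolding m1_def m2_def by linarith
  moreover have "frobenius_number S \<le> int l * F1 + int m * F2 + int l * int m"
    unfolding F1_def F2_def by (rule frobenius_number_le) (rule above_bound_in_glued)
  ultimately show "frobenius_number S - int (semigroup_multiplicity S) < p" by linarith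
qed

end

lemma minimal_generator_nonzero:
  assumes "submonoid S" "minimally_generates A S" "a \<in> A"
  shows "a \<in> S" "a \<noteq> 0"
  using assms(2,3) unfolding minimally_generates_iff[OF assms(1)] by auto

lemma one_not_decomposable:
  assumes "submonoid S" "minimally_generates A S" "1 \<in> S"
  shows "1 \<in> A"
  using assms(2,3) unfolding minimally_generates_iff[OF assms(1)] by auto

theorem proposition4p3:
  fixes n :: "nat \<Rightarrow> nat" and r e lam \<mu> :: nat and S\<^sub>1 S\<^sub>2 S :: "nat set"
  assumes "numerical_semigroup S\<^sub>1" and "numerical_semigroup S\<^sub>2"
    and "1 \<le> r" and "r < e"
    and "strict_mono_on {1..r} n" and "strict_mono_on {r+1..e} n"
    and "minimally_generates (n ` {1..r}) S\<^sub>1"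
    and "minimally_generates (n ` {r+1..e}) S\<^sub>2"
    and "maximal_reduced_type TYPE('k::{alg_closed_field, field_char_0}) S\<^sub>1"
    and "maximal_reduced_type TYPE('k) S\<^sub>2"
    and "is_gluing S lam \<mu> S\<^sub>1 (n ` {1..r}) S\<^sub>2 (n ` {r+1..e})"
    and "lam + \<mu> > max (lam * n 1) (\<mu> * n (r + 1))"
  shows "maximal_reduced_type TYPE('k) S"
proof -
  let ?A = "n ` {1..r}" and ?B = "n ` {r+1..e}"
  have sub1: "submonoid S\<^sub>1" and sub2: "submonoid S\<^sub>2"
    using assms(1,2) unfolding numerical_semigroup_def by blast+
  have \<mu>: "\<mu> \<in> S\<^sub>1" "\<mu> \<notin> ?A" and lam: "lam \<in> S\<^sub>2" "lam \<notin> ?B"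
    and gcd: "gcd lam \<mu> = 1" and glue: "S = glue lam \<mu> ?A ?B"
    using assms(11) unfolding is_gluing_def by auto
  have "\<mu> \<noteq> 1" "lam \<noteq> 1"
    using \<mu> lam one_not_decomposable[OF sub1 assms(7)] one_not_decomposable[OF sub2 assms(8)] by blast+
  \<comment> \<open>If one coefficient were \<open>0\<close>, coprimality would make the other \<open>1\<close>.\<close>
  then have pos: "\<mu> > 0" "lam > 0" using gcd by (auto intro: gr0I)
  have hull: "submonoid hull ?A = S\<^sub>1" "submonoid hull ?B = S\<^sub>2"
    using assms(7,8) unfolding minimally_generates_def by blast+
  interpret glued_semigroups S\<^sub>1 S\<^sub>2 S lam \<mu>
    using assms(1,2) \<mu> lam pos gcd glue unfolding glue_eq hull
    by unfold_locales (auto simp: coprime_iff_gcd_eq_1)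
  have "n 1 \<in> S\<^sub>1" "n 1 \<noteq> 0"
    using minimal_generator_nonzero[OF sub1 assms(7), of "n 1"] assms(3) by auto
  then have "semigroup_multiplicity S\<^sub>1 \<le> n 1" by (rule semigroup_multiplicity_le)
  then have "lam * semigroup_multiplicity S\<^sub>1 \<le> lam * n 1" by simp
  moreover have "n (r + 1) \<in> S\<^sub>2" "n (r + 1) \<noteq> 0"
    using minimal_generator_nonzero[OF sub2 assms(8), of "n (r + 1)"] assms(4) by auto
  then have "semigroup_multiplicity S\<^sub>2 \<le> n (r + 1)" by (rule semigroup_multiplicity_le)
  then have "\<mu> * semigroup_multiplicity S\<^sub>2 \<le> \<mu> * n (r + 1)" by simp
  ultimately have
    "max (lam * semigroup_multiplicity S\<^sub>1) (\<mu> * semigroup_multiplicity S\<^sub>2) < lam + \<mu>"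
    using assms(12) by linarith
  with assms(9,10) show ?thesis by (rule maximal_reduced_type_glued)
qed

end
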